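(* Consider the system $(F,L,P,\gamma)$ (as defined in the context). Let $v$ be Gaussian and let $y_i=v+q_i$, $i=1,\dots,k$, where the $q_i$ are zero-mean, of common finite variance $\sigma^2$, and pairwise correlated with correlation coefficient $\rho$, $-\frac1{k-1}<\rho\le0$. If for some $k'$ and $\rho$ the common variance $\sigma^2$ satisfies $$\sigma^2\le\frac{\gamma\,k'\,\|L_yP_{21}S\|^2}{\|S-1\|^2\,(\gamma-\|S-1\|^2)\,(1+(k'-1)\rho)},$$ then $y_1,\dots,y_k$ form a $(k,k')$ stabilizing code for the system $(F,L,P,\gamma)$.
   Context: Here $k\ge2$ and $1\le k'\le k$ are integers. System. $P$ is an open-loop unstable discrete-time LTI plant with state $x$ and input-output relation $\begin{bmatrix} e \\ y \end{bmatrix}=\begin{bmatrix} P_{11} & P_{12} \\ P_{21} & P_{22} \end{bmatrix}\begin{bmatrix} d \\ u \end{bmatrix}$, where the control input $u$ and the sensor output $y$ are scalar, $d$ is an external disturbance (the disturbance and the initial state are jointly Gaussian), and $e$ is an error signal. The feedback loop is $u=Fw$, $w=v+q$, $v=L_w z^{-1}w+L_y y$, where $F$ and $L=[L_w,L_y]$ are proper LTI filters making the loop internally stable and well posed, $z^{-1}$ is the one-step delay, and $q$ is additive white Gaussian noise of variance $\sigma_q^2$ modelling the coding noise. Put $S=(1-L_wz^{-1}-P_{22}FL_y)^{-1}$ and $K=FL_y(1-L_wz^{-1})^{-1}$. $\|\cdot\|$ is the $H_2$ norm. The signal-to-noise ratio is $\gamma=\sigma_v^2/\sigma_q^2$, where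 $\sigma_v^2$ is the variance of $v$; it satisfies $\gamma=\|S-1\|^2+\frac1{\sigma_q^2}\|L_yP_{21}S\|^2$. $(F,L,P,\gamma)$ denotes such a system, with average rate $\frac12\log_2(1+\gamma)$ and control performance (variance of $e$) $\sigma_e^2=\|P_{11}+P_{12}K(1-P_{22}K)^{-1}P_{21}\|^2+\|P_{12}FS\|^2\sigma_q^2$. Stabilizing code: a $(k,k')$ stabilizing code for $(F,L,P,\gamma)$ produces $k$ descriptions such that using any $k'$ of them is sufficient to stabilize the system. Descriptions are combined by averaging them, the average taking the role of $w$. Stability means mean-square stability, $\sup_n \mathbb{E}[x(n)x(n)^T]<\infty$, where $x(n)$ is the state at time $n$. *)

theory Defs
  imports "HOL-Probability.Probability"
begin

section \<open>Discrete-time LTI systems\<close>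

text \<open>
  A proper LTI system is given by a real state-space realisation; scalar signals are vectors
  over the one-element index type \<open>1\<close>.
\<close>

record ('n::finite, 'i::finite, 'o::finite) lti =
  matA :: "real^'n^'n"
  matB :: "real^'i^'n"
  matC :: "real^'n^'o"
  matD :: "real^'i^'o"

definition lti_run ::
  "('n::finite, 'i::finite, 'o::finite) lti \<Rightarrow> (nat \<Rightarrow> real^'n) \<Rightarrow> (nat \<Rightarrow> real^'i) \<Rightarrow> (nat \<Rightarrow> real^'o) \<Rightarrow> bool"
  where
  "lti_run G x u y \<longleftrightarrow>
     (\<forall>t. x (Suc t) = matA G *v x t + matB G *v u t \<and> y t = matC G *v x t + matD G *v u t)"

definition open_loop_unstable :: "('n::finite, 'i::finite, 'o::finite) lti \<Rightarrow> bool" where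
  "open_loop_unstable G \<longleftrightarrow> \<not> (\<forall>x0. (\<lambda>t. (((*v) (matA G)) ^^ t) x0) \<longlonglongrightarrow> 0)"

text \<open>\<open>C (z I - A)\<^sup>-\<^sup>1 B + D\<close>, meaningful when \<open>z\<close> is not an eigenvalue of \<open>A\<close>.\<close>

definition transfer ::
  "('n::finite, 'i::finite, 'o::finite) lti \<Rightarrow> complex \<Rightarrow> complex^'i^'o" where
  "transfer G z =
     map_matrix complex_of_real (matC G)
       ** matrix_inv (mat z - map_matrix complex_of_real (matA G))
       ** map_matrix complex_of_real (matB G)
     + map_matrix complex_of_real (matD G)"

text \<open>
  The \<open>H\<^sub>2\<close> norm of a stable transfer function, computed on the unit circle. On complex matrices
  \<open>norm\<close> is the Frobenius norm. The transfer functions measured below are stable under internal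
  stability; their defining formulas may be meaningless at finitely many points of the circle
  (poles of the open-loop blocks), which do not affect the integral.
\<close>

definition h2_norm :: "(complex \<Rightarrow> 'b::real_normed_vector) \<Rightarrow> real" where
  "h2_norm G = sqrt (1 / (2 * pi) * (LINT \<theta>:{-pi..pi}|lborel. (norm (G (cis \<theta>)))\<^sup>2))"


section \<open>The feedback loop\<close>

text \<open>
  The plant has input \<open>[d; u]\<close> and output \<open>[e; y]\<close>: index \<open>Inl _\<close> selects the components of \<open>d\<close>
  and \<open>e\<close>, index \<open>Inr 1\<close> the scalars \<open>u\<close> and \<open>y\<close>. The inputs of \<open>L\<close> are \<open>z\<^sup>-\<^sup>1 w\<close> (index 1) and
  \<open>y\<close> (index 2).
\<close>

type_synonym ('n, 'd, 'e) plant = "('n, 'd + 1, 'e + 1) lti"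
type_synonym 'f siso = "('f, 1, 1) lti"
type_synonym 'l two_in = "('l, 2, 1) lti"

definition stack :: "real^'d \<Rightarrow> real \<Rightarrow> real^('d::finite + 1)" where
  "stack a b = (\<chi> i. case i of Inl j \<Rightarrow> a $ j | Inr _ \<Rightarrow> b)"

text \<open>\<open>stH\<close> is the content of the delay element, i.e. the previous value of \<open>w\<close>.\<close>

record ('n::finite, 'f::finite, 'l::finite, 'd::finite, 'e::finite) signals =
  sd :: "nat \<Rightarrow> real^'d"
  se :: "nat \<Rightarrow> real^'e"
  su :: "nat \<Rightarrow> real"
  sy :: "nat \<Rightarrow> real"
  sv :: "nat \<Rightarrow> real"
  sw :: "nat \<Rightarrow> real"
  stP :: "nat \<Rightarrow> real^'n"
  stF :: "nat \<Rightarrow> real^'f"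
  stL :: "nat \<Rightarrow> real^'l"
  stH :: "nat \<Rightarrow> real"

definition loop_state ::
  "('n::finite, 'f::finite, 'l::finite, 'd::finite, 'e::finite) signals \<Rightarrow> nat
     \<Rightarrow> (real^'n) \<times> (real^'f) \<times> (real^'l) \<times> real" where
  "loop_state s t = (stP s t, stF s t, stL s t, stH s t)"

text \<open>
  Every relation of the loop except the one producing \<open>w\<close> from \<open>v\<close>, which depends on the
  channel (\<open>w = v + q\<close>, or an average of descriptions).
\<close>

definition loop_equations ::
  "('n::finite, 'd::finite, 'e::finite) plant \<Rightarrow> 'f::finite siso \<Rightarrow> 'l::finite two_in
     \<Rightarrow> ('n, 'f, 'l, 'd, 'e) signals \<Rightarrow> bool" where
  "loop_equations P F L s \<longleftrightarrow>
     lti_run P (stP s) (\<lambda>t. stack (sd s t) (su s t)) (\<lambda>t. stack (se s t) (sy s t)) \<and>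
     lti_run F (stF s) (\<lambda>t. vector [sw s t]) (\<lambda>t. vector [su s t]) \<and>
     lti_run L (stL s) (\<lambda>t. vector [stH s t, sy s t]) (\<lambda>t. vector [sv s t]) \<and>
     (\<forall>t. stH s (Suc t) = sw s t)"

text \<open>
  The left-hand side is the value at \<open>z = \<infinity>\<close> of \<open>1 - L\<^sub>w z\<^sup>-\<^sup>1 - P\<^sub>2\<^sub>2 F L\<^sub>y\<close>; it is nonzero iff the
  algebraic loop is uniquely solvable at each time.
\<close>

definition well_posed ::
  "('n::finite, 'd::finite, 'e::finite) plant \<Rightarrow> 'f::finite siso \<Rightarrow> 'l::finite two_in \<Rightarrow> bool" where
  "well_posed P F L \<longleftrightarrow>
     1 - matD P $ Inr 1 $ Inr 1 * matD F $ 1 $ 1 * matD L $ 1 $ 2 \<noteq> 0"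

definition internally_stable ::
  "('n::finite, 'd::finite, 'e::finite) plant \<Rightarrow> 'f::finite siso \<Rightarrow> 'l::finite two_in \<Rightarrow> bool" where
  "internally_stable P F L \<longleftrightarrow>
     (\<forall>s. loop_equations P F L s \<and> (\<forall>t. sd s t = 0) \<and> (\<forall>t. sw s t = sv s t)
        \<longrightarrow> loop_state s \<longlonglongrightarrow> 0)"

definition P21 :: "('n::finite, 'd::finite, 'e::finite) plant \<Rightarrow> complex \<Rightarrow> complex^'d" where
  "P21 P z = (\<chi> j. transfer P z $ Inr 1 $ Inl j)"

definition P22 :: "('n::finite, 'd::finite, 'e::finite) plant \<Rightarrow> complex \<Rightarrow> complex" where
  "P22 P z = transfer P z $ Inr 1 $ Inr 1"

definition tfF :: "'f::finite siso \<Rightarrow> complex \<Rightarrow> complex" where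
  "tfF F z = transfer F z $ 1 $ 1"

definition Lw :: "'l::finite two_in \<Rightarrow> complex \<Rightarrow> complex" where
  "Lw L z = transfer L z $ 1 $ 1"

definition Ly :: "'l::finite two_in \<Rightarrow> complex \<Rightarrow> complex" where
  "Ly L z = transfer L z $ 1 $ 2"

definition sens ::
  "('n::finite, 'd::finite, 'e::finite) plant \<Rightarrow> 'f::finite siso \<Rightarrow> 'l::finite two_in
     \<Rightarrow> complex \<Rightarrow> complex" where
  "sens P F L z = inverse (1 - Lw L z * inverse z - P22 P z * tfF F z * Ly L z)"

definition LyP21S ::
  "('n::finite, 'd::finite, 'e::finite) plant \<Rightarrow> 'f::finite siso \<Rightarrow> 'l::finite two_in
     \<Rightarrow> complex \<Rightarrow> complex^'d" where
  "LyP21S P F L z = (Ly L z * sens P F L z) *s P21 P z"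


section \<open>Random signals\<close>

definition mean :: "'a measure \<Rightarrow> ('a \<Rightarrow> real) \<Rightarrow> real" where
  "mean M X = integral\<^sup>L M X"

definition covariance :: "'a measure \<Rightarrow> ('a \<Rightarrow> real) \<Rightarrow> ('a \<Rightarrow> real) \<Rightarrow> real" where
  "covariance M X Y = mean M (\<lambda>\<omega>. (X \<omega> - mean M X) * (Y \<omega> - mean M Y))"

text \<open>Gaussian laws include the degenerate ones (constants).\<close>

definition gaussian :: "'a measure \<Rightarrow> ('a \<Rightarrow> real) \<Rightarrow> bool" where
  "gaussian M X \<longleftrightarrow> X \<in> borel_measurable M \<and>
     ((\<exists>\<mu>. AE \<omega> in M. X \<omega> = \<mu>) \<or>
      (\<exists>\<mu> \<sigma>. \<sigma> > 0 \<and> distributed M lborel X (\<lambda>x. ennreal (normal_density \<mu> \<sigma> x))))"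

text \<open>A vector and a vector process are jointly Gaussian iff all finite linear combinations of
  their components are Gaussian.\<close>

definition jointly_gaussian ::
  "'a measure \<Rightarrow> ('a \<Rightarrow> 'b::euclidean_space) \<Rightarrow> (nat \<Rightarrow> 'a \<Rightarrow> 'c::euclidean_space) \<Rightarrow> bool" where
  "jointly_gaussian M X d \<longleftrightarrow>
     (\<forall>a b T. gaussian M (\<lambda>\<omega>. a \<bullet> X \<omega> + (\<Sum>t<(T::nat). b t \<bullet> d t \<omega>)))"

definition white_unit :: "'a measure \<Rightarrow> (nat \<Rightarrow> 'a \<Rightarrow> real^'d::finite) \<Rightarrow> bool" where
  "white_unit M d \<longleftrightarrow>
     (\<forall>t i. mean M (\<lambda>\<omega>. d t \<omega> $ i) = 0) \<and>
     (\<forall>t t' i j. covariance M (\<lambda>\<omega>. d t \<omega> $ i) (\<lambda>\<omega>. d t' \<omega> $ j)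
                  = (if t = t' \<and> i = j then 1 else 0))"

definition awgn :: "'a measure \<Rightarrow> (nat \<Rightarrow> 'a \<Rightarrow> real) \<Rightarrow> real \<Rightarrow> bool" where
  "awgn M q \<sigma> \<longleftrightarrow> \<sigma> > 0 \<and>
     prob_space.indep_vars M (\<lambda>_. borel) q UNIV \<and>
     (\<forall>t. distributed M lborel (q t) (\<lambda>x. ennreal (normal_density 0 \<sigma> x)))"

text \<open>\<open>sup\<^sub>t E[x(t) x(t)\<^sup>T] < \<infinity>\<close>: the second-moment matrices exist and are bounded.\<close>

definition mean_square_stable :: "'a measure \<Rightarrow> (nat \<Rightarrow> 'a \<Rightarrow> real^'n::finite) \<Rightarrow> bool" where
  "mean_square_stable M x \<longleftrightarrow>
     (\<forall>t. x t \<in> borel_measurable M) \<and>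
     (\<forall>t i j. integrable M (\<lambda>\<omega>. x t \<omega> $ i * x t \<omega> $ j)) \<and>
     bounded (range (\<lambda>t. (\<chi> i j. mean M (\<lambda>\<omega>. x t \<omega> $ i * x t \<omega> $ j)) :: real^'n^'n))"


section \<open>Control systems and stabilizing codes\<close>

text \<open>The loop run on \<open>M\<close> with disturbance \<open>d\<close> and initial loop state \<open>\<xi>\<close>.\<close>

definition loop_on ::
  "('n::finite, 'd::finite, 'e::finite) plant \<Rightarrow> 'f::finite siso \<Rightarrow> 'l::finite two_in
     \<Rightarrow> 'a measure \<Rightarrow> (nat \<Rightarrow> 'a \<Rightarrow> real^'d) \<Rightarrow> ('a \<Rightarrow> (real^'n) \<times> (real^'f) \<times> (real^'l) \<times> real)
     \<Rightarrow> ('a \<Rightarrow> ('n, 'f, 'l, 'd, 'e) signals) \<Rightarrow> bool" where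
  "loop_on P F L M d \<xi> s \<longleftrightarrow>
     (\<forall>\<omega>\<in>space M. loop_equations P F L (s \<omega>) \<and> loop_state (s \<omega>) 0 = \<xi> \<omega> \<and>
                   (\<forall>t. sd (s \<omega>) t = d t \<omega>))"

text \<open>
  The system \<open>(F, L, P, \<gamma>)\<close> with coding noise \<open>q\<close> of standard deviation \<open>\<sigma>q\<close>. The variance
  \<open>\<sigma>\<^sub>v\<^sup>2\<close> in \<open>\<gamma> = \<sigma>\<^sub>v\<^sup>2 / \<sigma>\<^sub>q\<^sup>2\<close> is the steady-state one, since the loop starts at time 0 from \<open>\<xi>\<close>.
  The formula \<open>\<gamma> = \<parallel>S - 1\<parallel>\<^sup>2 + \<parallel>L\<^sub>y P\<^sub>2\<^sub>1 S\<parallel>\<^sup>2 / \<sigma>\<^sub>q\<^sup>2\<close> presupposes that \<open>d\<close> is white with identity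
  covariance.
\<close>

definition control_system ::
  "('n::finite, 'd::finite, 'e::finite) plant \<Rightarrow> 'f::finite siso \<Rightarrow> 'l::finite two_in \<Rightarrow> real
     \<Rightarrow> 'a measure \<Rightarrow> (nat \<Rightarrow> 'a \<Rightarrow> real^'d) \<Rightarrow> ('a \<Rightarrow> (real^'n) \<times> (real^'f) \<times> (real^'l) \<times> real)
     \<Rightarrow> (nat \<Rightarrow> 'a \<Rightarrow> real) \<Rightarrow> real \<Rightarrow> bool" where
  "control_system P F L \<gamma> M d \<xi> q \<sigma>q \<longleftrightarrow>
     prob_space M \<and> open_loop_unstable P \<and> well_posed P F L \<and> internally_stable P F L \<and>
     jointly_gaussian M \<xi> d \<and> white_unit M d \<and> awgn M q \<sigma>q \<and>
     prob_space.indep_set M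
       (sets (vimage_algebra (space M) (\<lambda>\<omega> t. q t \<omega>) (PiM UNIV (\<lambda>_. borel))))
       (sets (vimage_algebra (space M) (\<lambda>\<omega>. (\<xi> \<omega>, \<lambda>t. d t \<omega>)) (borel \<Otimes>\<^sub>M PiM UNIV (\<lambda>_. borel)))) \<and>
     (\<exists>s. loop_on P F L M d \<xi> s \<and>
          (\<forall>\<omega>\<in>space M. \<forall>t. sw (s \<omega>) t = sv (s \<omega>) t + q t \<omega>) \<and>
          (\<lambda>t. covariance M (\<lambda>\<omega>. sv (s \<omega>) t) (\<lambda>\<omega>. sv (s \<omega>) t) / \<sigma>q\<^sup>2) \<longlonglongrightarrow> \<gamma>)"

text \<open>
  A code \<open>c\<close> turns the signal \<open>v\<close> into descriptions \<open>c i v\<close>. When the descriptions in \<open>J\<close> are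
  received, their average drives the loop in place of \<open>w\<close>.
\<close>

type_synonym 'a code = "nat \<Rightarrow> (nat \<Rightarrow> 'a \<Rightarrow> real) \<Rightarrow> nat \<Rightarrow> 'a \<Rightarrow> real"

definition coded_loop ::
  "('n::finite, 'd::finite, 'e::finite) plant \<Rightarrow> 'f::finite siso \<Rightarrow> 'l::finite two_in
     \<Rightarrow> 'a measure \<Rightarrow> (nat \<Rightarrow> 'a \<Rightarrow> real^'d) \<Rightarrow> ('a \<Rightarrow> (real^'n) \<times> (real^'f) \<times> (real^'l) \<times> real)
     \<Rightarrow> 'a code \<Rightarrow> nat set \<Rightarrow> ('a \<Rightarrow> ('n, 'f, 'l, 'd, 'e) signals) \<Rightarrow> bool" where
  "coded_loop P F L M d \<xi> c J s \<longleftrightarrow>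
     loop_on P F L M d \<xi> s \<and>
     (\<forall>\<omega>\<in>space M. \<forall>t.
        sw (s \<omega>) t = (\<Sum>i\<in>J. c i (\<lambda>t' \<omega>'. sv (s \<omega>') t') t \<omega>) / real (card J))"

text \<open>The existence clause rules out codes that leave the loop without a solution.\<close>

definition stabilizing_code ::
  "('n::finite, 'd::finite, 'e::finite) plant \<Rightarrow> 'f::finite siso \<Rightarrow> 'l::finite two_in
     \<Rightarrow> 'a measure \<Rightarrow> (nat \<Rightarrow> 'a \<Rightarrow> real^'d) \<Rightarrow> ('a \<Rightarrow> (real^'n) \<times> (real^'f) \<times> (real^'l) \<times> real)
     \<Rightarrow> nat \<Rightarrow> nat \<Rightarrow> 'a code \<Rightarrow> bool" where
  "stabilizing_code P F L M d \<xi> k k' c \<longleftrightarrow>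
     (\<forall>J. J \<subseteq> {1..k} \<and> card J = k' \<longrightarrow>
        (\<exists>s. coded_loop P F L M d \<xi> c J s) \<and>
        (\<forall>s. coded_loop P F L M d \<xi> c J s \<longrightarrow> mean_square_stable M (\<lambda>t \<omega>. stP (s \<omega>) t)))"

definition additive_code :: "(nat \<Rightarrow> nat \<Rightarrow> 'a \<Rightarrow> real) \<Rightarrow> 'a code" where
  "additive_code q i v t \<omega> = v t \<omega> + q i t \<omega>"

end

theory Submission
  imports Defs
begin

text \<open>
  Averaging \<open>k'\<close> descriptions feeds \<open>v + n\<close> back into the loop, where \<open>n\<close> is the average of the
  noises involved and has second moment at most \<open>k' \<sigma>\<^sup>2\<close>, uniformly in time. Well-posedness turns
  the loop into a recursion \<open>z (t + 1) = T (z t) + B (d t, n t)\<close> with linear \<open>T\<close> and \<open>B\<close>, and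
  internal stability says that \<open>T\<^sup>t z \<rightarrow> 0\<close> for all \<open>z\<close>. In finite dimension this makes \<open>T\<close> a strict
  contraction for an equivalent norm \<open>V\<close>. If \<open>\<mu> < 1\<close> is the contraction factor, convexity of the
  square gives \<open>E (V z(t + 1))\<^sup>2 \<le> \<mu> E (V z(t))\<^sup>2 + c E \<parallel>(d t, n t)\<parallel>\<^sup>2\<close>, without any independence
  between the noise and the loop, so the second moments of the state stay bounded.
\<close>

section \<open>Stable linear recursions with random input\<close>

lemma linear_funpow: "linear (T :: 'z \<Rightarrow> 'z::real_vector) \<Longrightarrow> linear (T ^^ j)"
  by (induction j) (auto simp: linear_id intro: linear_compose)

text \<open>Pointwise decay on the finite basis makes a single power \<open>T ^^ N\<close> halve
  every norm. Summing suitably weighted norms along the first \<open>N\<close> iterates turns this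
  into a contraction at every step.\<close>

lemma stable_linear_adapted_norm:
  fixes T :: "'z::euclidean_space \<Rightarrow> 'z"
  assumes T: "linear T" and stable: "\<And>x. (\<lambda>t. (T ^^ t) x) \<longlonglongrightarrow> 0"
  obtains \<mu> V K where "0 < \<mu>" "\<mu> < 1" "continuous_on UNIV V" "\<And>x. norm x \<le> V x"
    "\<And>x. V x \<le> K * norm x" "\<And>x y. V (x + y) \<le> V x + V y" "\<And>x. V (T x) \<le> \<mu> * V x"
proof -
  have lin: "linear (T ^^ t)" for t
    using T by (rule linear_funpow)
  \<comment> \<open>A crude operator norm bound through the images of the basis vectors; its
    constant tends to 0 in \<open>t\<close> because the basis is finite.\<close>
  have bound: "norm ((T ^^ t) x) \<le> (\<Sum>b\<in>Basis. norm ((T ^^ t) b)) * norm x" for t x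
  proof -
    have "(T ^^ t) x = (T ^^ t) (\<Sum>b\<in>Basis. (x \<bullet> b) *\<^sub>R b)"
      by (simp add: euclidean_representation)
    also have "\<dots> = (\<Sum>b\<in>Basis. (x \<bullet> b) *\<^sub>R (T ^^ t) b)"
      by (simp add: linear_sum[OF lin] linear_scale[OF lin])
    also have "norm \<dots> \<le> (\<Sum>b\<in>Basis. norm x * norm ((T ^^ t) b))"
      by (rule sum_norm_le) (simp add: Basis_le_norm mult_right_mono)
    finally show ?thesis by (simp add: mult.commute flip: sum_distrib_left)
  qed
  have "(\<lambda>t. \<Sum>b\<in>Basis. norm ((T ^^ t) b)) \<longlonglongrightarrow> (\<Sum>b\<in>(Basis::'z set). norm (0::'z))"
    by (intro tendsto_sum tendsto_norm stable)
  then have "\<forall>\<^sub>F t in sequentially. (\<Sum>b\<in>Basis. norm ((T ^^ t) b)) < 1/2"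
    by (intro order_tendstoD) auto
  \<comment> \<open>Positivity of the exponent makes the root below meaningful and keeps the term
    \<open>j = 0\<close> in \<open>V\<close>, which yields \<open>norm x \<le> V x\<close>.\<close>
  then have "\<forall>\<^sub>F t in sequentially. (\<Sum>b\<in>Basis. norm ((T ^^ t) b)) < 1/2 \<and> t > 0"
    by (intro eventually_conj eventually_gt_at_top)
  then obtain N where N: "(\<Sum>b\<in>Basis. norm ((T ^^ N) b)) < 1/2" "N > 0"
    by (auto simp: eventually_sequentially)
  have half: "norm ((T ^^ N) x) \<le> norm x / 2" for x
    using bound[of N x] mult_right_mono[of "\<Sum>b\<in>Basis. norm ((T ^^ N) b)" "1/2" "norm x"] N(1)
    by simp
  txt \<open>\<open>\<mu>\<close> is chosen so that the weights \<open>\<mu>\<^sup>-\<^sup>j\<close> turn \<open>\<parallel>T\<^sup>N x\<parallel> \<le> \<parallel>x\<parallel> / 2\<close> into a one-step contraction.\<close>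
  define \<mu> :: real where "\<mu> = root N (1/2)"
  have \<mu>: "0 < \<mu>" "\<mu> < 1" "\<mu> ^ N = 1/2"
    using N(2) by (auto simp: \<mu>_def)
  \<comment> \<open>Replacing \<open>x\<close> by \<open>T x\<close> shifts the sum by one index, so
    each surviving term gains a factor \<open>\<mu>\<close>. The overflowing iterate
    \<open>T ^^ N\<close> is absorbed by the vacated term \<open>j = 0\<close>.\<close>
  define V where "V x = (\<Sum>j<N. norm ((T ^^ j) x) / \<mu> ^ j)" for x
  show ?thesis
  proof
    show "0 < \<mu>" "\<mu> < 1" using \<mu> by auto
    show "continuous_on UNIV V"
      unfolding V_def using \<mu>
      by (intro continuous_intros linear_continuous_on linear_conv_bounded_linear[THEN iffD1] lin) auto
    show "norm x \<le> V x" for x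
      unfolding V_def using N(2) \<mu> member_le_sum[of 0 "{..<N}" "\<lambda>j. norm ((T ^^ j) x) / \<mu> ^ j"]
      by simp
    show "V x \<le> (\<Sum>j<N. (\<Sum>b\<in>Basis. norm ((T ^^ j) b)) / \<mu> ^ j) * norm x" for x
      unfolding V_def sum_distrib_right
    proof (rule sum_mono)
      fix j
      show "norm ((T ^^ j) x) / \<mu> ^ j \<le> (\<Sum>b\<in>Basis. norm ((T ^^ j) b)) / \<mu> ^ j * norm x"
        using divide_right_mono[OF bound[of j x], of "\<mu> ^ j"] \<mu>(1) by simp
    qed
    show "V (x + y) \<le> V x + V y" for x y
      unfolding V_def sum.distrib[symmetric] using \<mu>
      by (intro sum_mono)
        (simp add: linear_add[OF lin] norm_triangle_ineq divide_right_mono flip: add_divide_distrib)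
    show "V (T x) \<le> \<mu> * V x" for x
    proof -
      obtain n where n: "N = Suc n" using N(2) by (cases N) auto
      have "V (T x) = (\<Sum>j<n. norm ((T ^^ Suc j) x) / \<mu> ^ j) + norm ((T ^^ N) x) / \<mu> ^ n"
        by (simp add: V_def n funpow_swap1)
      also have "norm ((T ^^ N) x) / \<mu> ^ n \<le> norm x / 2 / \<mu> ^ n"
        using half \<mu> by (intro divide_right_mono) auto
      \<comment> \<open>Since \<open>N = Suc n\<close> and \<open>\<mu> ^ N = 1/2\<close>, the
        factor \<open>1 / (2 * \<mu> ^ n)\<close> is exactly \<open>\<mu>\<close>.\<close>
      also have "norm x / 2 / \<mu> ^ n = \<mu> * norm x"
        using \<mu> by (simp add: n field_simps)
      also have "(\<Sum>j<n. norm ((T ^^ Suc j) x) / \<mu> ^ j)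
          = (\<Sum>j<n. \<mu> * (norm ((T ^^ Suc j) x) / \<mu> ^ Suc j))"
        using \<mu> by (intro sum.cong) auto
      also have "\<dots> + \<mu> * norm x = \<mu> * V x"
        unfolding V_def n sum.lessThan_Suc_shift by (simp add: sum_distrib_left algebra_simps)
      finally show ?thesis by simp
    qed
  qed
qed

section \<open>Second moments of a driven linear recursion\<close>

lemma norm_add_power2_le: "(norm (x + y))\<^sup>2 \<le> 2 * (norm x)\<^sup>2 + 2 * (norm (y::'a::real_normed_vector))\<^sup>2"
proof -
  have "(norm (x + y))\<^sup>2 \<le> (norm x + norm y)\<^sup>2"
    by (intro power_mono norm_triangle_ineq) auto
  also have "\<dots> \<le> 2 * (norm x)\<^sup>2 + 2 * (norm y)\<^sup>2"
    using zero_le_power2[of "norm x - norm y"] by (simp add: power2_sum power2_diff)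
  finally show ?thesis .
qed

lemma norm_linear_power2_le:
  fixes T :: "'x::euclidean_space \<Rightarrow> 'y::real_normed_vector"
  assumes "linear T"
  obtains c where "\<And>x. (norm (T x))\<^sup>2 \<le> c * (norm x)\<^sup>2"
proof -
  obtain c where "\<And>x. norm (T x) \<le> c * norm x"
    using linear_bounded[OF assms] by blast
  then have "(norm (T x))\<^sup>2 \<le> (c * norm x)\<^sup>2" for x
    by (intro power_mono) auto
  then show ?thesis
    using that[of "c\<^sup>2"] by (simp add: power_mult_distrib)
qed

text \<open>Finiteness at each single time, by induction, with no uniformity claimed. It licenses
  the integral inequalities behind the uniform bound, since a non-integrable function would have
  Bochner integral 0.\<close>

lemma driven_linear_square_integrable:
  fixes T :: "'z::euclidean_space \<Rightarrow> 'z" and B :: "'r::euclidean_space \<Rightarrow> 'z"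
  assumes T: "linear T" and B: "linear B"
    and z0: "z 0 \<in> borel_measurable M" "integrable M (\<lambda>\<omega>. (norm (z 0 \<omega>))\<^sup>2)"
    and r: "\<And>t. r t \<in> borel_measurable M" "\<And>t. integrable M (\<lambda>\<omega>. (norm (r t \<omega>))\<^sup>2)"
    and step: "\<And>t \<omega>. \<omega> \<in> space M \<Longrightarrow> z (Suc t) \<omega> = T (z t \<omega>) + B (r t \<omega>)"
  shows "z t \<in> borel_measurable M" and "integrable M (\<lambda>\<omega>. (norm (z t \<omega>))\<^sup>2)"
proof -
  have meas: "T \<in> borel_measurable borel" "B \<in> borel_measurable borel"
    using T B by (auto intro!: borel_measurable_continuous_onI linear_continuous_on
        simp: linear_conv_bounded_linear)
  obtain a where a: "\<And>x. (norm (T x))\<^sup>2 \<le> a * (norm x)\<^sup>2"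
    using norm_linear_power2_le[OF T] by blast
  obtain b where b: "\<And>x. (norm (B x))\<^sup>2 \<le> b * (norm x)\<^sup>2"
    using norm_linear_power2_le[OF B] by blast
  have "z t \<in> borel_measurable M \<and> integrable M (\<lambda>\<omega>. (norm (z t \<omega>))\<^sup>2)"
  proof (induction t)
    case 0
    then show ?case using z0 by simp
  next
    case (Suc t)
    have [measurable]: "z t \<in> borel_measurable M" "r t \<in> borel_measurable M"
      using Suc r by auto
    note [measurable] = meas
    have m: "z (Suc t) \<in> borel_measurable M"
      by (subst measurable_cong[OF step]) auto
    have "integrable M (\<lambda>\<omega>. (norm (z (Suc t) \<omega>))\<^sup>2)"
    proof (rule Bochner_Integration.integrable_bound)
      show "integrable M (\<lambda>\<omega>. 2 * (a * (norm (z t \<omega>))\<^sup>2) + 2 * (b * (norm (r t \<omega>))\<^sup>2))"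
        using Suc r by auto
      show "AE \<omega> in M. norm ((norm (z (Suc t) \<omega>))\<^sup>2)
          \<le> norm (2 * (a * (norm (z t \<omega>))\<^sup>2) + 2 * (b * (norm (r t \<omega>))\<^sup>2))"
      proof (rule AE_I2)
        fix \<omega> assume "\<omega> \<in> space M"
        then show "norm ((norm (z (Suc t) \<omega>))\<^sup>2)
          \<le> norm (2 * (a * (norm (z t \<omega>))\<^sup>2) + 2 * (b * (norm (r t \<omega>))\<^sup>2))"
          using norm_add_power2_le[of "T (z t \<omega>)" "B (r t \<omega>)"] a[of "z t \<omega>"] b[of "r t \<omega>"]
          by (simp add: step)
      qed
    qed (use m in measurable)
    with m show ?case ..
  qed
  then show "z t \<in> borel_measurable M" and "integrable M (\<lambda>\<omega>. (norm (z t \<omega>))\<^sup>2)"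
    by auto
qed

text \<open>Convexity of the square at the points \<open>a\<close> and
  \<open>b / (1 - \<mu>)\<close> with weights \<open>\<mu>\<close> and \<open>1 - \<mu>\<close>. The
  coefficient of the square of \<open>a\<close> stays below 1, which a plain factor 2 would
  destroy.\<close>

lemma convex_power2_le:
  fixes a b \<mu> :: real
  assumes "0 < \<mu>" "\<mu> < 1"
  shows "(\<mu> * a + b)\<^sup>2 \<le> \<mu> * a\<^sup>2 + b\<^sup>2 / (1 - \<mu>)"
proof -
  define c where "c = b / (1 - \<mu>)"
  have b: "b = (1 - \<mu>) * c"
    using assms by (simp add: c_def)
  have "b\<^sup>2 / (1 - \<mu>) = (1 - \<mu>) * c\<^sup>2"
    using assms by (simp add: b power2_eq_square)
  \<comment> \<open>The gap is the variance of a two-point law on \<open>a\<close> and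
    \<open>c\<close> with these weights.\<close>
  then have "\<mu> * a\<^sup>2 + b\<^sup>2 / (1 - \<mu>) - (\<mu> * a + b)\<^sup>2 = \<mu> * (1 - \<mu>) * (a - c)\<^sup>2"
    by (simp add: b power2_eq_square algebra_simps)
  moreover have "0 \<le> \<mu> * (1 - \<mu>) * (a - c)\<^sup>2"
    using assms by simp
  ultimately show ?thesis by linarith
qed

text \<open>Integrating the pathwise inequality \<open>V_step\<close> gives an affine recursion with
  slope \<open>\<mu> < 1\<close> for the second moments of \<open>V\<close>. Cross terms of state
  and input are removed pathwise, so their joint law does not enter.\<close>

lemma driven_stable_linear_mean_square_bounded:
  fixes T :: "'z::euclidean_space \<Rightarrow> 'z" and B :: "'r::euclidean_space \<Rightarrow> 'z"
  assumes T: "linear T" and stable: "\<And>x. (\<lambda>t. (T ^^ t) x) \<longlonglongrightarrow> 0" and B: "linear B"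
    and z0: "z 0 \<in> borel_measurable M" "integrable M (\<lambda>\<omega>. (norm (z 0 \<omega>))\<^sup>2)"
    and r: "\<And>t. r t \<in> borel_measurable M" "\<And>t. integrable M (\<lambda>\<omega>. (norm (r t \<omega>))\<^sup>2)"
    and r_bound: "\<And>t. (LINT \<omega>|M. (norm (r t \<omega>))\<^sup>2) \<le> R"
    and step: "\<And>t \<omega>. \<omega> \<in> space M \<Longrightarrow> z (Suc t) \<omega> = T (z t \<omega>) + B (r t \<omega>)"
  obtains C where "\<And>t. (LINT \<omega>|M. (norm (z t \<omega>))\<^sup>2) \<le> C"
proof -
  obtain \<mu> V K where \<mu>: "0 < \<mu>" "\<mu> < 1" and cont: "continuous_on UNIV V"
    and V_ge: "\<And>x. norm x \<le> V x" and V_le: "\<And>x. V x \<le> K * norm x"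
    and V_add: "\<And>x y. V (x + y) \<le> V x + V y" and V_T: "\<And>x. V (T x) \<le> \<mu> * V x"
    by (rule stable_linear_adapted_norm[OF T stable], rule that)
  obtain b where b: "\<And>x. (norm (B x))\<^sup>2 \<le> b * (norm x)\<^sup>2"
    using norm_linear_power2_le[OF B] by blast
  have zt: "z t \<in> borel_measurable M" "integrable M (\<lambda>\<omega>. (norm (z t \<omega>))\<^sup>2)" for t
    using driven_linear_square_integrable[where z = z, OF T B z0 r] step by auto
  have [measurable]: "V \<in> borel_measurable borel"
    using cont by (rule borel_measurable_continuous_onI)
  have [measurable]: "z t \<in> borel_measurable M" for t
    by (rule zt(1))
  have V0: "0 \<le> V x" for x
    using V_ge[of x] norm_ge_zero[of x] by linarith
  have V2: "(V x)\<^sup>2 \<le> K\<^sup>2 * (norm x)\<^sup>2" for x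
    using power_mono[OF V_le[of x] V0, of 2] by (simp add: power_mult_distrib)
  have int: "integrable M (\<lambda>\<omega>. (V (z t \<omega>))\<^sup>2)" for t
    by (rule Bochner_Integration.integrable_bound[OF integrable_mult_right[OF zt(2)[of t], of "K\<^sup>2"]])
      (auto simp: V2)
  \<comment> \<open>The absolute value is taken because \<open>b\<close> comes without a sign, while
    \<open>c\<close> must be nonnegative to multiply the bound \<open>R\<close>.\<close>
  define c where "c = K\<^sup>2 * \<bar>b\<bar> / (1 - \<mu>)"
  have c: "0 \<le> c" using \<mu> by (simp add: c_def)
  have V_step: "(V (z (Suc t) \<omega>))\<^sup>2 \<le> \<mu> * (V (z t \<omega>))\<^sup>2 + c * (norm (r t \<omega>))\<^sup>2"
    if "\<omega> \<in> space M" for t \<omega>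
  proof -
    have "V (z (Suc t) \<omega>) \<le> \<mu> * V (z t \<omega>) + V (B (r t \<omega>))"
      using V_add[of "T (z t \<omega>)" "B (r t \<omega>)"] V_T[of "z t \<omega>"] that by (simp add: step)
    then have "(V (z (Suc t) \<omega>))\<^sup>2 \<le> (\<mu> * V (z t \<omega>) + V (B (r t \<omega>)))\<^sup>2"
      by (intro power_mono V0)
    also have "\<dots> \<le> \<mu> * (V (z t \<omega>))\<^sup>2 + (V (B (r t \<omega>)))\<^sup>2 / (1 - \<mu>)"
      using \<mu> by (rule convex_power2_le)
    also have "(V (B (r t \<omega>)))\<^sup>2 \<le> K\<^sup>2 * (norm (B (r t \<omega>)))\<^sup>2"
      by (rule V2)
    also have "(norm (B (r t \<omega>)))\<^sup>2 \<le> b * (norm (r t \<omega>))\<^sup>2"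
      by (rule b)
    also have "b * (norm (r t \<omega>))\<^sup>2 \<le> \<bar>b\<bar> * (norm (r t \<omega>))\<^sup>2"
      by (intro mult_right_mono) auto
    finally show ?thesis
      using \<mu> by (simp add: c_def mult_left_mono divide_right_mono mult.assoc)
  qed
  \<comment> \<open>\<open>c * R / (1 - \<mu>)\<close> is the fixed point of the affine recursion;
    the maximum with the initial value makes \<open>D\<close> valid at time 0 and preserved by each
    step.\<close>
  define D where "D = max (LINT \<omega>|M. (V (z 0 \<omega>))\<^sup>2) (c * R / (1 - \<mu>))"
  have V_bound: "(LINT \<omega>|M. (V (z t \<omega>))\<^sup>2) \<le> D" for t
  proof (induction t)
    case 0
    show ?case by (simp add: D_def)
  next
    case (Suc t)
    have "(LINT \<omega>|M. (V (z (Suc t) \<omega>))\<^sup>2)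
        \<le> (LINT \<omega>|M. \<mu> * (V (z t \<omega>))\<^sup>2 + c * (norm (r t \<omega>))\<^sup>2)"
      by (intro integral_mono Bochner_Integration.integrable_add integrable_mult_right int r V_step)
    also have "\<dots> = \<mu> * (LINT \<omega>|M. (V (z t \<omega>))\<^sup>2) + c * (LINT \<omega>|M. (norm (r t \<omega>))\<^sup>2)"
      by (subst Bochner_Integration.integral_add) (auto intro!: integrable_mult_right int r)
    also have "\<dots> \<le> \<mu> * D + c * R"
      using Suc \<mu> c r_bound[of t] by (intro add_mono mult_left_mono) auto
    also have "c * R \<le> (1 - \<mu>) * D"
      using \<mu> by (simp add: D_def max_def field_simps)
    finally show ?case by (simp add: algebra_simps)
  qed
  have "(LINT \<omega>|M. (norm (z t \<omega>))\<^sup>2) \<le> D" for t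
    by (rule order.trans[OF integral_mono[OF zt(2) int[of t]] V_bound]) (simp add: power_mono V_ge)
  then show ?thesis by (rule that)
qed


section \<open>The loop as a linear recursion\<close>

lemma stack_add: "stack (a + a') (b + b') = stack a b + stack a' b'"
  by (simp add: stack_def vec_eq_iff split: sum.split)

lemma stack_scaleR: "stack (c *\<^sub>R a) (c * b) = c *\<^sub>R stack a b"
  by (simp add: stack_def vec_eq_iff split: sum.split)

lemma stack_split: "stack a b = stack a 0 + b *\<^sub>R stack 0 1"
  by (simp add: stack_def vec_eq_iff split: sum.split)

lemma stack_0_1: "stack (0::real^'d::finite) 1 = axis (Inr 1) 1"
  by (auto simp: stack_def vec_eq_iff axis_def num1_eq1 split: sum.split)

lemma matrix_vector_mult_stack:
  fixes A :: "real^('d::finite + 1)^'o::finite"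
  shows "(A *v stack a b) $ i = (A *v stack a 0) $ i + A $ i $ Inr 1 * b"
  by (subst stack_split) (simp add: matrix_vector_right_distrib matrix_vector_mult_scaleR
      stack_0_1 matrix_vector_mult_basis column_def)

lemma matrix_vector_mult_1: "((A::real^1^'o) *v vector [a]) $ i = A $ i $ 1 * a"
  by (simp add: matrix_vector_mult_def)

lemma matrix_vector_mult_2: "((A::real^2^'o) *v vector [a, b]) $ i = A $ i $ 1 * a + A $ i $ 2 * b"
  by (simp add: matrix_vector_mult_def sum_2)

section \<open>Solving the algebraic loop and iterating it\<close>

context
  fixes P :: "('n::finite, 'd::finite, 'e::finite) plant"
    and F :: "'f::finite siso" and L :: "'l::finite two_in"
begin

text \<open>The value of \<open>y\<close> obtained by eliminating \<open>u\<close> and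
  \<open>v\<close> from the equations at one time. Here \<open>z\<close> holds the states of plant,
  \<open>F\<close>, \<open>L\<close> and delay, \<open>r\<close> holds disturbance and channel
  noise, and the divisor is the quantity in \<open>well_posed\<close>.\<close>

definition plant_output :: "(real^'n) \<times> (real^'f) \<times> (real^'l) \<times> real \<Rightarrow> (real^'d) \<times> real \<Rightarrow> real" where
  "plant_output z r = (case (z, r) of ((x, f, l, h), (d, q)) \<Rightarrow>
     ((matC P *v x) $ Inr 1 + (matD P *v stack d 0) $ Inr 1
       + matD P $ Inr 1 $ Inr 1 * ((matC F *v f) $ 1
           + matD F $ 1 $ 1 * ((matC L *v l) $ 1 + matD L $ 1 $ 1 * h + q)))
     / (1 - matD P $ Inr 1 $ Inr 1 * matD F $ 1 $ 1 * matD L $ 1 $ 2))"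

definition encoder_output :: "(real^'n) \<times> (real^'f) \<times> (real^'l) \<times> real \<Rightarrow> (real^'d) \<times> real \<Rightarrow> real" where
  "encoder_output z r = (case z of (x, f, l, h) \<Rightarrow>
     (matC L *v l) $ 1 + matD L $ 1 $ 1 * h + matD L $ 1 $ 2 * plant_output z r)"

definition control_input :: "(real^'n) \<times> (real^'f) \<times> (real^'l) \<times> real \<Rightarrow> (real^'d) \<times> real \<Rightarrow> real" where
  "control_input z r = (case (z, r) of ((x, f, l, h), (d, q)) \<Rightarrow>
     (matC F *v f) $ 1 + matD F $ 1 $ 1 * (encoder_output z r + q))"

definition loop_step ::
    "(real^'n) \<times> (real^'f) \<times> (real^'l) \<times> real \<Rightarrow> (real^'d) \<times> real
      \<Rightarrow> (real^'n) \<times> (real^'f) \<times> (real^'l) \<times> real" where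
  "loop_step z r = (case (z, r) of ((x, f, l, h), (d, q)) \<Rightarrow>
     (matA P *v x + matB P *v stack d (control_input z r),
      matA F *v f + matB F *v vector [encoder_output z r + q],
      matA L *v l + matB L *v vector [h, plant_output z r],
      encoder_output z r + q))"

lemma plant_output_linear:
  "plant_output (z + z') (r + r') = plant_output z r + plant_output z' r'"
  "plant_output (c *\<^sub>R z) (c *\<^sub>R r) = c * plant_output z r"
  by (auto simp: stack_add[of _ _ 0 0, simplified] stack_scaleR[of _ _ 0, simplified]
      plant_output_def split_beta matrix_vector_right_distrib
      matrix_vector_mult_scaleR algebra_simps add_divide_distrib
      simp flip: add_divide_distrib)

lemma encoder_output_linear:
  "encoder_output (z + z') (r + r') = encoder_output z r + encoder_output z' r'"
  "encoder_output (c *\<^sub>R z) (c *\<^sub>R r) = c * encoder_output z r"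
  by (auto simp: encoder_output_def split_beta plant_output_linear matrix_vector_right_distrib
      matrix_vector_mult_scaleR algebra_simps)

lemma control_input_linear:
  "control_input (z + z') (r + r') = control_input z r + control_input z' r'"
  "control_input (c *\<^sub>R z) (c *\<^sub>R r) = c * control_input z r"
  by (auto simp: control_input_def split_beta encoder_output_linear matrix_vector_right_distrib
      matrix_vector_mult_scaleR algebra_simps)

lemma loop_step_linear:
  "loop_step (z + z') (r + r') = loop_step z r + loop_step z' r'"
  "loop_step (c *\<^sub>R z) (c *\<^sub>R r) = c *\<^sub>R loop_step z r"
proof -
  show "loop_step (z + z') (r + r') = loop_step z r + loop_step z' r'"
    by (auto simp: loop_step_def split_beta encoder_output_linear control_input_linear
      plant_output_linear stack_add matrix_vector_right_distrib 
      vec_eq_iff matrix_vector_mult_1 matrix_vector_mult_2 algebra_simps)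
  show "loop_step (c *\<^sub>R z) (c *\<^sub>R r) = c *\<^sub>R loop_step z r"
    by (auto simp: loop_step_def split_beta encoder_output_linear control_input_linear
      plant_output_linear stack_scaleR matrix_vector_mult_scaleR
      vec_eq_iff matrix_vector_mult_1 matrix_vector_mult_2 algebra_simps)
qed

text \<open>Joint linearity in state and input, with one argument set to 0, yields the two maps
  \<open>T\<close> and \<open>B\<close> of the recursion.\<close>

lemma linear_loop_step: "linear (\<lambda>z. loop_step z 0)" "linear (loop_step 0)"
  using loop_step_linear(1)[of _ _ 0 0] loop_step_linear(1)[of 0 0]
    loop_step_linear(2)[of _ _ 0] loop_step_linear(2)[of _ 0]
  by (auto intro!: linearI)

lemma loop_step_split: "loop_step z r = loop_step z 0 + loop_step 0 r"
  using loop_step_linear(1)[of z 0 0 r] by simp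

text \<open>At a fixed time the loop is a linear system in \<open>y\<close>, \<open>u\<close> and
  \<open>v\<close>, uniquely solvable by well-posedness. The sequence \<open>q\<close> is arbitrary,
  so both the noise-free loop and the loop with averaged noise are covered.\<close>

lemma loop_state_Suc:
  assumes wp: "well_posed P F L" and eqs: "loop_equations P F L s"
    and w: "sw s t = sv s t + q t"
  shows "loop_state s (Suc t) = loop_step (loop_state s t) (sd s t, q t)"
proof -
  define \<Delta> where "\<Delta> = 1 - matD P $ Inr 1 $ Inr 1 * matD F $ 1 $ 1 * matD L $ 1 $ 2"
  have \<Delta>: "\<Delta> \<noteq> 0" using wp by (simp add: well_posed_def \<Delta>_def)
  note e = eqs[unfolded loop_equations_def lti_run_def]
  have y: "sy s t = (matC P *v stP s t) $ Inr 1 + (matD P *v stack (sd s t) 0) $ Inr 1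
      + matD P $ Inr 1 $ Inr 1 * su s t"
  proof -
    have "stack (se s t) (sy s t) $ Inr 1 = (matC P *v stP s t + matD P *v stack (sd s t) (su s t)) $ Inr 1"
      using e by simp
    then show ?thesis
      by (simp add: stack_def[of "se s t"] matrix_vector_mult_stack[of _ _ "su s t"])
  qed
  have u: "su s t = (matC F *v stF s t) $ 1 + matD F $ 1 $ 1 * sw s t"
  proof -
    have "(vector [su s t] :: real^1) $ 1 = (matC F *v stF s t + matD F *v vector [sw s t]) $ 1"
      using e by simp
    then show ?thesis by (simp add: matrix_vector_mult_1)
  qed
  have v: "sv s t = (matC L *v stL s t) $ 1 + matD L $ 1 $ 1 * stH s t + matD L $ 1 $ 2 * sy s t"
  proof -
    have "(vector [sv s t] :: real^1) $ 1 = (matC L *v stL s t + matD L *v vector [stH s t, sy s t]) $ 1"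
      using e by simp
    then show ?thesis by (simp add: matrix_vector_mult_2)
  qed
  \<comment> \<open>Substituting \<open>v\<close>, \<open>w\<close> and \<open>u\<close> into
    \<open>y\<close> and collecting the direct feedthrough of \<open>y\<close> on the left.\<close>
  have "sy s t * \<Delta> = (matC P *v stP s t) $ Inr 1 + (matD P *v stack (sd s t) 0) $ Inr 1
      + matD P $ Inr 1 $ Inr 1 * ((matC F *v stF s t) $ 1
          + matD F $ 1 $ 1 * ((matC L *v stL s t) $ 1 + matD L $ 1 $ 1 * stH s t + q t))"
    unfolding \<Delta>_def right_diff_distrib using y u v w by (simp add: algebra_simps)
  then have y': "sy s t = plant_output (loop_state s t) (sd s t, q t)"
    using \<Delta> unfolding plant_output_def loop_state_def \<Delta>_def[symmetric] by (simp add: eq_divide_eq)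
  then have v': "sv s t = encoder_output (loop_state s t) (sd s t, q t)"
    by (simp add: encoder_output_def loop_state_def v)
  then have u': "su s t = control_input (loop_state s t) (sd s t, q t)"
    by (simp add: control_input_def loop_state_def u w)
  show ?thesis
    using e w v' u' y' by (simp add: loop_step_def loop_state_def)
qed

text \<open>The recursion is run forward and the signals are read off. This provides the solutions
  demanded of a stabilizing code, and a trajectory from each initial state to which internal
  stability can be applied.\<close>

lemma ex_loop_signals:
  assumes wp: "well_posed P F L"
  obtains s where "loop_equations P F L s" "loop_state s 0 = z0" "sd s = d"
    "\<And>t. sw s t = sv s t + q t"
proof -
  define Z where "Z = rec_nat z0 (\<lambda>t z. loop_step z (d t, q t))"
  define X f l h where "X t = fst (Z t)" and "f t = fst (snd (Z t))"
    and "l t = fst (snd (snd (Z t)))" and "h t = snd (snd (snd (Z t)))" for t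
  have Z: "Z t = (X t, f t, l t, h t)" for t
    by (simp add: X_def f_def l_def h_def)
  define y v u where "y t = plant_output (Z t) (d t, q t)"
    and "v t = encoder_output (Z t) (d t, q t)" and "u t = control_input (Z t) (d t, q t)" for t
  have v: "v t = (matC L *v l t) $ 1 + matD L $ 1 $ 1 * h t + matD L $ 1 $ 2 * y t" for t
    by (simp add: v_def y_def encoder_output_def Z)
  have u: "u t = (matC F *v f t) $ 1 + matD F $ 1 $ 1 * (v t + q t)" for t
    by (simp add: v_def u_def control_input_def Z)
  have y: "y t = (matC P *v X t) $ Inr 1 + (matD P *v stack (d t) 0) $ Inr 1
      + matD P $ Inr 1 $ Inr 1 * u t" for t
  proof -
    have "y t * (1 - matD P $ Inr 1 $ Inr 1 * matD F $ 1 $ 1 * matD L $ 1 $ 2)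
      = (matC P *v X t) $ Inr 1 + (matD P *v stack (d t) 0) $ Inr 1
       + matD P $ Inr 1 $ Inr 1 * ((matC F *v f t) $ 1
           + matD F $ 1 $ 1 * ((matC L *v l t) $ 1 + matD L $ 1 $ 1 * h t + q t))"
      using wp by (simp add: y_def Z plant_output_def well_posed_def)
    then show ?thesis
      unfolding u v by (simp add: algebra_simps)
  qed
  have Z_Suc: "Z (Suc t) = loop_step (Z t) (d t, q t)" for t
    by (simp add: Z_def)
  have step: "X (Suc t) = matA P *v X t + matB P *v stack (d t) (u t)"
    "f (Suc t) = matA F *v f t + matB F *v vector [v t + q t]"
    "l (Suc t) = matA L *v l t + matB L *v vector [h t, y t]"
    "h (Suc t) = v t + q t" for t
    using Z_Suc[of t] by (simp_all add: Z[of "Suc t"] Z[of t] loop_step_def u_def v_def y_def)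
  \<comment> \<open>The error \<open>se\<close> does not occur in the recursion and is read off from
    the \<open>Inl\<close> rows of the plant output.\<close>
  define s where "s = \<lparr>sd = d,
      se = (\<lambda>t. \<chi> i. (matC P *v X t + matD P *v stack (d t) (u t)) $ Inl i),
      su = u, sy = y, sv = v, sw = (\<lambda>t. v t + q t), stP = X, stF = f, stL = l, stH = h\<rparr>"
  have "loop_equations P F L s"
    unfolding loop_equations_def lti_run_def s_def
    apply (simp add: step vec_eq_iff)
    using u v y
    by (auto simp: stack_def[of "\<chi> i. _ i"] matrix_vector_mult_stack[of _ _ "u _"] num1_eq1
      matrix_vector_mult_1 matrix_vector_mult_2 split: sum.split)
  moreover have "loop_state s 0 = z0"
    using Z[of 0] by (simp add: s_def loop_state_def) (simp add: Z_def)
  ultimately show ?thesis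
    by (intro that[of s]) (auto simp: s_def)
qed

text \<open>Iterating with zero input reproduces the genuine loop trajectory with
  \<open>d = 0\<close> and \<open>w = v\<close>, the case governed by
  \<open>internally_stable\<close>.\<close>

lemma loop_step_stable:
  assumes wp: "well_posed P F L" and stable: "internally_stable P F L"
  shows "(\<lambda>t. ((\<lambda>z. loop_step z 0) ^^ t) z0) \<longlonglongrightarrow> 0"
proof -
  obtain s where s: "loop_equations P F L s" "loop_state s 0 = z0" "sd s = (\<lambda>_. 0)"
    "\<And>t. sw s t = sv s t + 0"
    using ex_loop_signals[OF wp, of z0 "\<lambda>_. 0" "\<lambda>_. 0"] by blast
  have "((\<lambda>z. loop_step z 0) ^^ t) z0 = loop_state s t" for t
    by (induction t) (use s loop_state_Suc[OF wp s(1), of _ "\<lambda>_. 0"] in \<open>auto simp: zero_prod_def\<close>)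
  moreover have "loop_state s \<longlonglongrightarrow> 0"
    using stable s unfolding internally_stable_def by simp
  ultimately show ?thesis
    by simp
qed

end


section \<open>Second moments\<close>

lemma gaussian_square_integrable:
  assumes "gaussian M X" and "prob_space M"
  shows "X \<in> borel_measurable M" and "integrable M (\<lambda>\<omega>. (X \<omega>)\<^sup>2)"
proof -
  interpret prob_space M by fact
  show [measurable]: "X \<in> borel_measurable M"
    using assms by (simp add: gaussian_def)
  consider (const) \<mu> where "AE \<omega> in M. X \<omega> = \<mu>"
    | (normal) \<mu> \<sigma> where "\<sigma> > 0" "distributed M lborel X (\<lambda>x. ennreal (normal_density \<mu> \<sigma> x))"
    using assms unfolding gaussian_def by blast
  then show "integrable M (\<lambda>\<omega>. (X \<omega>)\<^sup>2)"
  proof cases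
    case const
    then have "AE \<omega> in M. (X \<omega>)\<^sup>2 = \<mu>\<^sup>2" by auto
    then have "integrable M (\<lambda>\<omega>. (X \<omega>)\<^sup>2) \<longleftrightarrow> integrable M (\<lambda>\<omega>. \<mu>\<^sup>2)"
      by (intro integrable_cong_AE) auto
    then show ?thesis by simp
  next
    case normal
    have moment: "integrable M (\<lambda>\<omega>. (X \<omega> - \<mu>) ^ n)" for n
      using integrable_normal_moment[OF normal(1), of \<mu> n]
        distributed_integrable[OF normal(2), of "\<lambda>x. (x - \<mu>) ^ n"] by simp
    \<comment> \<open>The square of \<open>X\<close> expanded around \<open>\<mu>\<close>; the
      exponent 1 lets \<open>moment\<close> apply to the linear term.\<close>
    have "integrable M (\<lambda>\<omega>. (X \<omega> - \<mu>)\<^sup>2 + 2 * \<mu> * (X \<omega> - \<mu>) ^ 1 + \<mu>\<^sup>2)"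
      by (intro Bochner_Integration.integrable_add integrable_mult_right moment) simp
    then show ?thesis by (simp add: power2_eq_square algebra_simps)
  qed
qed

lemma integrable_norm_power2:
  fixes X :: "'a \<Rightarrow> 'z::euclidean_space"
  assumes "\<And>b. b \<in> Basis \<Longrightarrow> integrable M (\<lambda>\<omega>. (b \<bullet> X \<omega>)\<^sup>2)"
  shows "integrable M (\<lambda>\<omega>. (norm (X \<omega>))\<^sup>2)"
proof -
  have "(norm (X \<omega>))\<^sup>2 = (\<Sum>b\<in>Basis. (b \<bullet> X \<omega>)\<^sup>2)" for \<omega>
    unfolding power2_norm_eq_inner
    by (subst euclidean_inner) (simp add: inner_commute power2_eq_square)
  then show ?thesis
    using assms by simp
qed

text \<open>Each product of two components is dominated by the squared norm, so one scalar bound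
  controls every entry of the second-moment matrix.\<close>

lemma mean_square_stableI:
  fixes x :: "nat \<Rightarrow> 'a \<Rightarrow> real^'n::finite"
  assumes meas: "\<And>t. x t \<in> borel_measurable M"
    and int: "\<And>t. integrable M (\<lambda>\<omega>. (norm (x t \<omega>))\<^sup>2)"
    and bound: "\<And>t. (LINT \<omega>|M. (norm (x t \<omega>))\<^sup>2) \<le> C"
  shows "mean_square_stable M x"
proof -
  have [measurable]: "(\<lambda>\<omega>. x t \<omega> $ i) \<in> borel_measurable M" for t i
    by (rule measurable_compose[OF meas])
      (intro borel_measurable_continuous_onI continuous_intros)
  have le: "\<bar>x t \<omega> $ i * x t \<omega> $ j\<bar> \<le> (norm (x t \<omega>))\<^sup>2" for t \<omega> i j
    using mult_mono[OF component_le_norm_cart[of "x t \<omega>" i] component_le_norm_cart[of "x t \<omega>" j]]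
    by (simp add: power2_eq_square abs_mult)
  have int': "integrable M (\<lambda>\<omega>. x t \<omega> $ i * x t \<omega> $ j)" for t i j
    by (rule Bochner_Integration.integrable_bound[OF int[of t]]) (auto simp: le)
  have C: "\<bar>mean M (\<lambda>\<omega>. x t \<omega> $ i * x t \<omega> $ j)\<bar> \<le> C" for t i j
    unfolding mean_def
    by (rule order.trans[OF integral_abs_bound
          order.trans[OF integral_mono[OF integrable_abs[OF int'] int] bound]]) (rule le)
  have "norm ((\<chi> i j. mean M (\<lambda>\<omega>. x t \<omega> $ i * x t \<omega> $ j)) :: real^'n^'n)
      \<le> (\<Sum>i\<in>(UNIV::'n set). \<Sum>j\<in>(UNIV::'n set). C)" for t
  proof -
    let ?A = "(\<chi> i j. mean M (\<lambda>\<omega>. x t \<omega> $ i * x t \<omega> $ j)) :: real^'n^'n"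
    have "norm ?A \<le> (\<Sum>i\<in>UNIV. norm (?A $ i))"
      unfolding norm_vec_def[of ?A] by (rule L2_set_le_sum) simp
    also have "\<dots> \<le> (\<Sum>i\<in>(UNIV::'n set). \<Sum>j\<in>(UNIV::'n set). C)"
      by (intro sum_mono order.trans[OF norm_le_l1_cart]) (simp add: C)
    finally show ?thesis .
  qed
  then have "bounded (range (\<lambda>t. (\<chi> i j. mean M (\<lambda>\<omega>. x t \<omega> $ i * x t \<omega> $ j)) :: real^'n^'n))"
    unfolding bounded_iff by blast
  then show ?thesis
    unfolding mean_square_stable_def using meas int' by blast
qed

lemma gaussian_vector_square_integrable:
  fixes X :: "'a \<Rightarrow> 'z::euclidean_space"
  assumes "\<And>a. gaussian M (\<lambda>\<omega>. a \<bullet> X \<omega>)" and "prob_space M"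
  shows "X \<in> borel_measurable M" and "integrable M (\<lambda>\<omega>. (norm (X \<omega>))\<^sup>2)"
proof -
  show "X \<in> borel_measurable M"
    by (subst borel_measurable_euclidean_space)
      (auto simp: inner_commute[of "X _"] intro: gaussian_square_integrable assms)
  show "integrable M (\<lambda>\<omega>. (norm (X \<omega>))\<^sup>2)"
    by (intro integrable_norm_power2 gaussian_square_integrable assms)
qed

lemma jointly_gaussian_marginals:
  assumes "jointly_gaussian M X d"
  shows "gaussian M (\<lambda>\<omega>. a \<bullet> X \<omega>)" and "gaussian M (\<lambda>\<omega>. b \<bullet> d t \<omega>)"
proof -
  have *: "gaussian M (\<lambda>\<omega>. a \<bullet> X \<omega> + (\<Sum>s<T. c s \<bullet> d s \<omega>))" for a c and T :: nat
    using assms by (simp add: jointly_gaussian_def)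
  show "gaussian M (\<lambda>\<omega>. a \<bullet> X \<omega>)"
    using *[of a "\<lambda>_. 0" 0] by simp
  show "gaussian M (\<lambda>\<omega>. b \<bullet> d t \<omega>)"
    \<comment> \<open>Only the coefficient at time \<open>t\<close> is nonzero; the horizon is
      \<open>Suc t\<close> because the sum runs over \<open>s < T\<close>.\<close>
    using *[of 0 "\<lambda>s. if s = t then b else 0" "Suc t"]
    by (simp add: if_distrib[where f = "\<lambda>v. v \<bullet> _"] cong: if_cong)
qed

text \<open>With mean zero the variances are raw second moments, each equal to 1. The result is
  independent of \<open>t\<close>, as the uniform input bound requires.\<close>

lemma white_unit_square_norm:
  fixes d :: "nat \<Rightarrow> 'a \<Rightarrow> real^'d::finite"
  assumes "white_unit M d" and int: "\<And>i. integrable M (\<lambda>\<omega>. (d t \<omega> $ i)\<^sup>2)"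
  shows "(LINT \<omega>|M. (norm (d t \<omega>))\<^sup>2) = CARD('d)"
proof -
  have "(norm (d t \<omega>))\<^sup>2 = (\<Sum>i\<in>UNIV. (d t \<omega> $ i)\<^sup>2)" for \<omega>
    unfolding power2_norm_eq_inner inner_vec_def by (simp add: power2_eq_square)
  moreover have "(LINT \<omega>|M. (d t \<omega> $ i)\<^sup>2) = 1" for i
  proof -
    have "mean M (\<lambda>\<omega>. d t \<omega> $ i) = 0" and "covariance M (\<lambda>\<omega>. d t \<omega> $ i) (\<lambda>\<omega>. d t \<omega> $ i) = 1"
      using assms(1) by (auto simp: white_unit_def)
    then have "mean M (\<lambda>\<omega>. d t \<omega> $ i * d t \<omega> $ i) = 1"
      by (simp add: covariance_def)
    then show ?thesis by (simp add: mean_def power2_eq_square)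
  qed
  ultimately show ?thesis
    by (simp add: int)
qed

text \<open>Gaussianity of \<open>v\<close> is stated for each index set and each solution, since
  \<open>v\<close> is produced by the loop and depends on the descriptions averaged. The covariances
  of the noises are prescribed between descriptions at equal times.\<close>

theorem lemma5:
  fixes P :: "('n::finite, 'd::finite, 'e::finite) plant"
    and F :: "'f::finite siso" and L :: "'l::finite two_in"
    and M :: "'a measure" and d :: "nat \<Rightarrow> 'a \<Rightarrow> real^'d"
    and \<xi> :: "'a \<Rightarrow> (real^'n) \<times> (real^'f) \<times> (real^'l) \<times> real"
    and q0 :: "nat \<Rightarrow> 'a \<Rightarrow> real" and q :: "nat \<Rightarrow> nat \<Rightarrow> 'a \<Rightarrow> real"
    and \<gamma> \<sigma>q \<sigma> \<rho> :: real and k k' :: nat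
  assumes "2 \<le> k" and "1 \<le> k'" and "k' \<le> k"
    and system: "control_system P F L \<gamma> M d \<xi> q0 \<sigma>q"
    and v_gaussian: "\<And>J s t. J \<subseteq> {1..k} \<Longrightarrow> card J = k' \<Longrightarrow>
           coded_loop P F L M d \<xi> (additive_code q) J s \<Longrightarrow> gaussian M (\<lambda>\<omega>. sv (s \<omega>) t)"
    and q_measurable: "\<And>i t. i \<in> {1..k} \<Longrightarrow> q i t \<in> borel_measurable M"
    and q_square_integrable: "\<And>i t. i \<in> {1..k} \<Longrightarrow> integrable M (\<lambda>\<omega>. (q i t \<omega>)\<^sup>2)"
    and q_mean: "\<And>i t. i \<in> {1..k} \<Longrightarrow> mean M (q i t) = 0"
    and q_variance: "\<And>i t. i \<in> {1..k} \<Longrightarrow> covariance M (q i t) (q i t) = \<sigma>\<^sup>2"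
    and q_correlation: "\<And>i j t. i \<in> {1..k} \<Longrightarrow> j \<in> {1..k} \<Longrightarrow> i \<noteq> j \<Longrightarrow>
           covariance M (q i t) (q j t) = \<rho> * \<sigma>\<^sup>2"
    and "- 1 / (real k - 1) < \<rho>" and "\<rho> \<le> 0"
    and "\<sigma>\<^sup>2 \<le> \<gamma> * real k' * (h2_norm (LyP21S P F L))\<^sup>2 /
           ((h2_norm (\<lambda>z. sens P F L z - 1))\<^sup>2 * (\<gamma> - (h2_norm (\<lambda>z. sens P F L z - 1))\<^sup>2)
             * (1 + (real k' - 1) * \<rho>))"
  shows "stabilizing_code P F L M d \<xi> k k' (additive_code q)"
proof -
  have "prob_space M" and wp: "well_posed P F L" and stable: "internally_stable P F L"
    and jg: "jointly_gaussian M \<xi> d" and white: "white_unit M d"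
    using system by (auto simp: control_system_def)
  note \<xi> = gaussian_vector_square_integrable[OF jointly_gaussian_marginals(1)[OF jg] \<open>prob_space M\<close>]
  note d = gaussian_vector_square_integrable[OF jointly_gaussian_marginals(2)[OF jg] \<open>prob_space M\<close>]
  have "integrable M (\<lambda>\<omega>. (d t \<omega> $ i)\<^sup>2)" for t i
    using gaussian_square_integrable(2)[OF jointly_gaussian_marginals(2)[OF jg, of "axis i 1" t]
      \<open>prob_space M\<close>] by (simp add: inner_axis')
  then have d_norm: "(LINT \<omega>|M. (norm (d t \<omega>))\<^sup>2) = CARD('d)" for t
    by (rule white_unit_square_norm[OF white])
  have q_second_moment: "(LINT \<omega>|M. (q i t \<omega>)\<^sup>2) = \<sigma>\<^sup>2" if "i \<in> {1..k}" for i t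
    using q_variance[OF that, of t] q_mean[OF that, of t]
    by (simp add: covariance_def mean_def power2_eq_square)
  show ?thesis
    unfolding stabilizing_code_def
  proof (intro allI impI)
    fix J assume J: "J \<subseteq> {1..k} \<and> card J = k'"
    then have J': "finite J" "card J > 0" "\<And>i. i \<in> J \<Longrightarrow> i \<in> {1..k}"
      using \<open>1 \<le> k'\<close> by (auto intro: finite_subset)
    define n where "n t \<omega> = (\<Sum>i\<in>J. q i t \<omega>) / card J" for t \<omega>
    have average: "(\<Sum>i\<in>J. additive_code q i v t \<omega>) / card J = v t \<omega> + n t \<omega>" for v t \<omega>
      using J'(2) by (simp add: card_gt_0_iff additive_code_def n_def sum.distrib add_divide_distrib)
    define r where "r t \<omega> = (d t \<omega>, n t \<omega>)" for t \<omega>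
    have n_meas[measurable]: "n t \<in> borel_measurable M" for t
      unfolding n_def using J'(3) by (intro borel_measurable_divide borel_measurable_sum q_measurable) auto
    have r_meas: "r t \<in> borel_measurable M" for t
      unfolding r_def using d(1) by measurable
    \<comment> \<open>Cauchy-Schwarz, then \<open>card J\<close> is enlarged to its square to cancel
      the denominator of the average. The remaining sum has a known expectation.\<close>
    have n_le: "(n t \<omega>)\<^sup>2 \<le> (\<Sum>i\<in>J. (q i t \<omega>)\<^sup>2)" for t \<omega>
    proof -
      have "(\<Sum>i\<in>J. q i t \<omega>)\<^sup>2 \<le> (\<Sum>i\<in>J. (q i t \<omega>)\<^sup>2) * card J"
        by (rule sum_squared_le_sum_of_squares)
      also have "\<dots> \<le> (\<Sum>i\<in>J. (q i t \<omega>)\<^sup>2) * (real (card J))\<^sup>2"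
        using J'(2) by (intro mult_left_mono self_le_power) (auto simp: sum_nonneg)
      finally show ?thesis
        using J'(2) by (simp add: n_def power_divide divide_le_eq)
    qed
    have q_int: "integrable M (\<lambda>\<omega>. \<Sum>i\<in>J. (q i t \<omega>)\<^sup>2)" for t
      using J'(3) q_square_integrable by auto
    have n_int: "integrable M (\<lambda>\<omega>. (n t \<omega>)\<^sup>2)" for t
      by (rule Bochner_Integration.integrable_bound[OF q_int[of t]]) (auto simp: n_le sum_nonneg)
    have n_bound: "(LINT \<omega>|M. (n t \<omega>)\<^sup>2) \<le> card J * \<sigma>\<^sup>2" for t
    proof -
      have "(LINT \<omega>|M. (n t \<omega>)\<^sup>2) \<le> (LINT \<omega>|M. (\<Sum>i\<in>J. (q i t \<omega>)\<^sup>2))"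
        by (intro integral_mono n_int q_int n_le)
      also have "\<dots> = (\<Sum>i\<in>J. \<sigma>\<^sup>2)"
        using J'(3) q_square_integrable q_second_moment
        by (subst Bochner_Integration.integral_sum) auto
      finally show ?thesis by simp
    qed
    have r_norm: "(norm (r t \<omega>))\<^sup>2 = (norm (d t \<omega>))\<^sup>2 + (n t \<omega>)\<^sup>2" for t \<omega>
      by (simp add: r_def norm_Pair)
    have r_int: "integrable M (\<lambda>\<omega>. (norm (r t \<omega>))\<^sup>2)" for t
      by (simp add: r_norm d(2) n_int)
    have r_bound: "(LINT \<omega>|M. (norm (r t \<omega>))\<^sup>2) \<le> CARD('d) + card J * \<sigma>\<^sup>2" for t
      using n_bound[of t] by (simp add: r_norm d(2) n_int d_norm)
    show "(\<exists>s. coded_loop P F L M d \<xi> (additive_code q) J s) \<and>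
        (\<forall>s. coded_loop P F L M d \<xi> (additive_code q) J s
          \<longrightarrow> mean_square_stable M (\<lambda>t \<omega>. stP (s \<omega>) t))"
    proof (intro conjI allI impI)
      \<comment> \<open>Solutions are built separately for each \<open>\<omega>\<close> and then
        assembled by choice.\<close>
      have "\<exists>s. loop_equations P F L s \<and> loop_state s 0 = \<xi> \<omega> \<and> sd s = (\<lambda>t. d t \<omega>) \<and>
          (\<forall>t. sw s t = sv s t + n t \<omega>)" for \<omega>
        using ex_loop_signals[OF wp, of "\<xi> \<omega>" "\<lambda>t. d t \<omega>" "\<lambda>t. n t \<omega>"] by metis
      then obtain s where "\<And>\<omega>. loop_equations P F L (s \<omega>) \<and> loop_state (s \<omega>) 0 = \<xi> \<omega> \<and>
          sd (s \<omega>) = (\<lambda>t. d t \<omega>) \<and> (\<forall>t. sw (s \<omega>) t = sv (s \<omega>) t + n t \<omega>)"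
        by metis
      then show "\<exists>s. coded_loop P F L M d \<xi> (additive_code q) J s"
        by (intro exI[of _ s]) (simp add: coded_loop_def loop_on_def average)
    next
      fix s assume "coded_loop P F L M d \<xi> (additive_code q) J s"
      then have s: "loop_equations P F L (s \<omega>)" "loop_state (s \<omega>) 0 = \<xi> \<omega>"
          "sd (s \<omega>) t = d t \<omega>" "sw (s \<omega>) t = sv (s \<omega>) t + n t \<omega>"
        if "\<omega> \<in> space M" for \<omega> t
        using that by (auto simp: coded_loop_def loop_on_def average)
      define z where "z t \<omega> = loop_state (s \<omega>) t" for t \<omega>
      have step: "z (Suc t) \<omega> = loop_step P F L (z t \<omega>) 0 + loop_step P F L 0 (r t \<omega>)"
        if "\<omega> \<in> space M" for t \<omega>
        using loop_state_Suc[OF wp s(1)[OF that], of t "\<lambda>t. n t \<omega>"] s(3,4)[OF that, of t]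
        by (simp add: z_def r_def flip: loop_step_split)
      \<comment> \<open>An arbitrary solution is not assumed measurable. Its initial state agrees
        with \<open>\<xi>\<close> on \<open>space M\<close>, and the recursion carries measurability
        forward from there.\<close>
      have z0: "z 0 \<in> borel_measurable M" "integrable M (\<lambda>\<omega>. (norm (z 0 \<omega>))\<^sup>2)"
        using \<xi> s(2) by (simp_all add: z_def cong: measurable_cong Bochner_Integration.integrable_cong)
      note linear = linear_loop_step[of P F L]
      have z: "z t \<in> borel_measurable M" "integrable M (\<lambda>\<omega>. (norm (z t \<omega>))\<^sup>2)" for t
        using driven_linear_square_integrable[where z = z, OF linear z0 r_meas r_int] step by auto
      obtain C where C: "\<And>t. (LINT \<omega>|M. (norm (z t \<omega>))\<^sup>2) \<le> C"
        using driven_stable_linear_mean_square_bounded[OF linear(1) loop_step_stable[OF wp stable]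
          linear(2) z0 r_meas r_int r_bound step] by blast
      have fst_z: "stP (s \<omega>) t = fst (z t \<omega>)" for \<omega> t
        by (simp add: z_def loop_state_def)
      have le: "(norm (stP (s \<omega>) t))\<^sup>2 \<le> (norm (z t \<omega>))\<^sup>2" for \<omega> t
        unfolding fst_z using norm_fst_le[of "fst (z t \<omega>)" "snd (z t \<omega>)"] by (intro power_mono) auto
      have meas: "(\<lambda>\<omega>. stP (s \<omega>) t) \<in> borel_measurable M" for t
        unfolding fst_z
        by (rule measurable_compose[OF z(1)])
          (intro borel_measurable_continuous_onI continuous_on_fst continuous_on_id)
      have int: "integrable M (\<lambda>\<omega>. (norm (stP (s \<omega>) t))\<^sup>2)" for t
        by (rule Bochner_Integration.integrable_bound[OF z(2)[of t]]) (use meas le in auto)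
      have "(LINT \<omega>|M. (norm (stP (s \<omega>) t))\<^sup>2) \<le> C" for t
        by (rule order.trans[OF integral_mono[OF int z(2)] C]) (rule le)
      with meas int show "mean_square_stable M (\<lambda>t \<omega>. stP (s \<omega>) t)"
        by (intro mean_square_stableI)
    qed
  qed
qed

end
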